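(* $(\widetilde{S}^m_{nc},H_{\rm end})$ is the completion of $(\widetilde{S}^m,H_{\rm end})$; that is, $(\widetilde{S}^m_{nc},H_{\rm end})$ is a complete metric space containing $\widetilde{S}^m$ as a dense subset.
   Context: A fuzzy set on $\mathbb{R}^m$ is a function $u:\mathbb{R}^m\to[0,1]$. For $\alpha\in(0,1]$, $[u]_\alpha=\{x:u(x)\ge\alpha\}$, and $[u]_0=\overline{\{x:u(x)>0\}}$. $\widetilde{S}^m_{nc}$ (noncompact general fuzzy star-shaped numbers) is the set of all fuzzy sets $u$ on $\mathbb{R}^m$ such that: $u$ is upper semi-continuous; $u$ is normal, i.e. $u(x_0)=1$ for some $x_0$; for each $\lambda\in(0,1]$ there is $x_\lambda\in[u]_\lambda$ such that the line segment $\overline{x_\lambda y}$ is contained in $[u]_\lambda$ for all $y\in[u]_\lambda$; and $[u]_\alpha$ is bounded for each $\alpha\in(0,1]$. $\widetilde{S}^m$ (general fuzzy star-shaped numbers) is the set of those fuzzy sets satisfying the first three of these conditions and with $[u]_0$ bounded. The endograph of $u$ is ${\rm end}\,u=\{(x,t)\in\mathbb{R}^m\times[0,1]:u(x)\ge t\}$, and the endograph metric is $H_{\rm end}(u,v)=H({\rm end}\,u,{\rm end}\,v)$, where $H(A,B)=\max\{\sup_{a\in A}\inf_{b\in B}d(a,b),\ \sup_{b\in B}\inf_{a\in A}d(a,b)\}$ is the Hausdorff metric on nonempty closed sets ($d$ Euclidean). *)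

theory Defs
  imports "HOL-Analysis.Analysis"
begin

typedef 'a fuzzy_set = "{u :: 'a \<Rightarrow> real. \<forall>x. u x \<in> {0..1}}"
  morphisms grade Fuzzy_set
  by (rule exI[of _ "\<lambda>_. 0"]) simp

definition upper_semicontinuous :: "('a::topological_space \<Rightarrow> real) \<Rightarrow> bool" where
  "upper_semicontinuous f \<longleftrightarrow> (\<forall>x. \<forall>c > f x. \<forall>\<^sub>F y in at x. f y < c)"

text \<open>The cut at level \<open>0\<close> is the closed support; \<open>\<alpha>\<close> is only meant to range over \<open>[0, 1]\<close>.\<close>
definition cut :: "'a::topological_space fuzzy_set \<Rightarrow> real \<Rightarrow> 'a set" where
  "cut u \<alpha> = (if \<alpha> = 0 then closure {x. grade u x > 0} else {x. grade u x \<ge> \<alpha>})"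

text \<open>The centre of the star-shaped cut at level \<open>\<alpha>\<close> may depend on \<open>\<alpha>\<close>.\<close>
definition star_shaped_fuzzy :: "(real ^ 'n) fuzzy_set \<Rightarrow> bool" where
  "star_shaped_fuzzy u \<longleftrightarrow>
     upper_semicontinuous (grade u) \<and>
     (\<exists>x0. grade u x0 = 1) \<and>
     (\<forall>\<alpha>\<in>{0<..1}. starlike (cut u \<alpha>))"

definition star_numbers_nc :: "(real ^ 'n) fuzzy_set set" where
  "star_numbers_nc = {u. star_shaped_fuzzy u \<and> (\<forall>\<alpha>\<in>{0<..1}. bounded (cut u \<alpha>))}"

definition star_numbers :: "(real ^ 'n) fuzzy_set set" where
  "star_numbers = {u. star_shaped_fuzzy u \<and> bounded (cut u 0)}"

definition endograph :: "'a fuzzy_set \<Rightarrow> ('a \<times> real) set" where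
  "endograph u = {(x, t). t \<in> {0..1} \<and> grade u x \<ge> t}"

text \<open>
  This is only meaningful for nonempty sets with bounded excess over one another. It always is
  for endographs: they contain all points \<open>(x, 0)\<close>, so the two suprema are at most \<open>1\<close>.
\<close>
definition hausdorff_distance :: "'a::metric_space set \<Rightarrow> 'a set \<Rightarrow> real" where
  "hausdorff_distance A B = max (SUP a\<in>A. infdist a B) (SUP b\<in>B. infdist b A)"

text \<open>The metric on the product type \<open>'a \<times> real\<close> is the Euclidean one.\<close>
definition H_end :: "'a::metric_space fuzzy_set \<Rightarrow> 'a fuzzy_set \<Rightarrow> real" where
  "H_end u v = hausdorff_distance (endograph u) (endograph v)"

end

theory Submission
  imports Defs
begin

text \<open>
  Endographs of upper semicontinuous functions are closed subsets of a space whose bounded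
  sequences have convergent subsequences, and \<open>H_end\<close> is the Hausdorff distance of these sets.
  Each endograph contains all points \<open>(x, 0)\<close> and is contained in \<open>UNIV \<times> {0..1}\<close>, so a point
  of one endograph is at distance at most \<open>1\<close> from any other, and
  the metric axioms then hold as for compact sets.

  Completeness has two parts. First, closed sets are complete under uniform convergence of their
  distance functions (\<open>uniform_limit_infdist\<close>), and a limit of endographs is an endograph, so a
  Cauchy sequence \<open>u\<^sub>n\<close> has an upper semicontinuous limit \<open>v\<close> (\<open>H_end_Cauchy_converges\<close>). Second,
  \<open>v\<close> is again star-shaped with bounded cuts (\<open>star_numbers_nc_limit\<close>). If \<open>H_end u\<^sub>n v < \<alpha> / 2\<close>,
  then \<open>[v]\<^sub>\<alpha>\<close> lies within \<open>\<alpha> / 2\<close> of the bounded cut of \<open>u\<^sub>n\<close> at level \<open>\<alpha> / 2\<close>, which gives the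
  bounded cuts. In turn, points of \<open>u\<^sub>n\<close> at levels bounded away from \<open>0\<close> stay near a bounded cut of
  \<open>v\<close>, so they accumulate, and by closedness their accumulation points have at least the limiting
  grade in \<open>v\<close>. Applied to points of grade \<open>1\<close> this gives normality; applied to centres of the cuts
  of \<open>u\<^sub>n\<close> at levels slightly below \<open>\<alpha>\<close> it gives a centre of \<open>[v]\<^sub>\<alpha>\<close> (\<open>starlike_cut_of_limit\<close>).

  Density holds because replacing all grades below \<open>e\<close> by \<open>0\<close> makes the support bounded and moves
  the endograph by at most \<open>e\<close> (\<open>star_numbers_dense\<close>).
\<close>

section \<open>The endograph distance\<close>

lemma grade_bounds [simp]: "0 \<le> grade u x" "grade u x \<le> 1"
  using grade[of u] by auto

lemma mem_endograph: "(x, t) \<in> endograph u \<longleftrightarrow> 0 \<le> t \<and> t \<le> 1 \<and> t \<le> grade u x"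
  by (simp add: endograph_def)

lemma endograph_nonempty [simp]: "endograph u \<noteq> {}"
  using mem_endograph[of _ 0 u] by fastforce

lemma mem_cut: "\<alpha> > 0 \<Longrightarrow> x \<in> cut u \<alpha> \<longleftrightarrow> \<alpha> \<le> grade u x"
  by (simp add: cut_def)

lemma endograph_inject: "endograph u = endograph v \<longleftrightarrow> u = v"
proof
  assume eq: "endograph u = endograph v"
  have "grade u x = grade v x" for x
    using eq mem_endograph[of x "grade u x" u] mem_endograph[of x "grade u x" v]
      mem_endograph[of x "grade v x" u] mem_endograph[of x "grade v x" v]
    by (intro antisym) auto
  then show "u = v"
    by (metis ext grade_inject)
qed simp

lemma infdist_endograph_le_1:
  fixes u v :: "'a::metric_space fuzzy_set"
  assumes "p \<in> endograph u"
  shows "infdist p (endograph v) \<le> 1"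
proof -
  obtain x t where p: "p = (x, t)" by force
  have "(x, 0) \<in> endograph v"
    by (simp add: mem_endograph)
  moreover have "dist p (x, 0) \<le> 1"
    using assms by (simp add: p dist_Pair_Pair mem_endograph)
  ultimately show ?thesis
    by (rule infdist_le2)
qed

lemma H_end_le_iff:
  fixes u v :: "'a::metric_space fuzzy_set"
  shows "H_end u v \<le> e \<longleftrightarrow> (\<forall>p\<in>endograph u. infdist p (endograph v) \<le> e)
      \<and> (\<forall>p\<in>endograph v. infdist p (endograph u) \<le> e)"
proof -
  have bdd: "bdd_above ((\<lambda>p. infdist p (endograph b)) ` endograph a)"
    for a b :: "'a fuzzy_set"
    by (rule bdd_aboveI2[where M = 1]) (rule infdist_endograph_le_1)
  show ?thesis
    by (simp add: H_end_def hausdorff_distance_def cSUP_le_iff[OF endograph_nonempty bdd])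
qed

lemma infdist_le_H_end:
  fixes u v :: "'a::metric_space fuzzy_set"
  shows "p \<in> endograph u \<Longrightarrow> infdist p (endograph v) \<le> H_end u v"
  using H_end_le_iff[of u v "H_end u v"] by blast

lemma H_end_commute: "H_end u v = H_end v u"
  by (simp add: H_end_def hausdorff_distance_def max.commute)

lemma H_end_nonneg: "0 \<le> H_end u v"
proof -
  obtain p where "p \<in> endograph u"
    using endograph_nonempty by blast
  from infdist_le_H_end[OF this] show ?thesis
    using infdist_nonneg order_trans by blast
qed

text \<open>
  The Hausdorff distance bounds the uniform distance of the two distance functions: from \<open>p\<close> one
  goes to a nearly closest point of one set, and from there to the other set.
\<close>
lemma infdist_endograph_diff_le:
  fixes u v :: "'a::metric_space fuzzy_set"
  shows "\<bar>infdist p (endograph u) - infdist p (endograph v)\<bar> \<le> H_end u v"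
proof -
  have "infdist p (endograph a) \<le> infdist p (endograph b) + H_end a b"
    for a b :: "'a fuzzy_set"
  proof -
    have "infdist p (endograph a) - H_end a b \<le> dist p q" if "q \<in> endograph b" for q
      using infdist_triangle[of p "endograph a" q] infdist_le_H_end[OF that, of a]
        H_end_commute[of a b] by simp
    then have "infdist p (endograph a) - H_end a b \<le> infdist p (endograph b)"
      by (simp add: infdist_notempty cINF_greatest)
    then show ?thesis by simp
  qed
  from this[of u v] this[of v u] show ?thesis
    by (simp add: H_end_commute abs_le_iff)
qed

lemma H_end_triangle:
  fixes u v w :: "'a::metric_space fuzzy_set"
  shows "H_end u w \<le> H_end u v + H_end v w"
proof -
  have "infdist p (endograph b) \<le> H_end a v + H_end v b"
    if "p \<in> endograph a" for p and a b :: "'a fuzzy_set"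
    using infdist_le_H_end[OF that, of v] infdist_endograph_diff_le[of p v b] by simp
  then show ?thesis
    by (metis H_end_commute H_end_le_iff add.commute)
qed

section \<open>Upper semicontinuity and closed endographs\<close>

lemma upper_semicontinuous_iff_closed_endograph:
  fixes u :: "'a::metric_space fuzzy_set"
  shows "upper_semicontinuous (grade u) \<longleftrightarrow> closed (endograph u)"
proof
  assume usc: "upper_semicontinuous (grade u)"
  show "closed (endograph u)"
    unfolding closed_sequential_limits
  proof (intro allI impI)
    fix p :: "nat \<Rightarrow> 'a \<times> real" and l
    assume "(\<forall>n. p n \<in> endograph u) \<and> p \<longlonglongrightarrow> l"
    then have p: "\<And>n. p n \<in> endograph u" and lim: "p \<longlonglongrightarrow> l" by auto
    obtain x t where l: "l = (x, t)" by force
    have fst: "(\<lambda>n. fst (p n)) \<longlonglongrightarrow> x" and snd: "(\<lambda>n. snd (p n)) \<longlonglongrightarrow> t"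
      using tendsto_fst[OF lim] tendsto_snd[OF lim] by (auto simp: l)
    have bounds: "0 \<le> snd (p n)" "snd (p n) \<le> 1" "snd (p n) \<le> grade u (fst (p n))" for n
      using p[of n] by (auto simp: endograph_def)
    have "t \<le> grade u x"
    proof (rule ccontr)
      assume "\<not> t \<le> grade u x"
      then obtain c where c: "grade u x < c" "c < t"
        using dense by (metis not_le)
      from usc c(1) have "\<forall>\<^sub>F y in at x. grade u y < c"
        by (auto simp: upper_semicontinuous_def)
      with c(1) have "\<forall>\<^sub>F y in nhds x. grade u y < c"
        by (auto simp: eventually_nhds_conv_at)
      with fst have "\<forall>\<^sub>F n in sequentially. grade u (fst (p n)) < c"
        by (auto simp: filterlim_iff)
      moreover have "\<forall>\<^sub>F n in sequentially. c < snd (p n)"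
        using snd c(2) by (rule order_tendstoD)
      ultimately have "\<forall>\<^sub>F n in sequentially. False"
        by eventually_elim (use bounds in \<open>meson less_trans not_less\<close>)
      then show False by simp
    qed
    moreover have "0 \<le> t" "t \<le> 1"
      using bounds by (auto intro: tendsto_lowerbound[OF snd] tendsto_upperbound[OF snd])
    ultimately show "l \<in> endograph u"
      by (simp add: l mem_endograph)
  qed
next
  assume cl: "closed (endograph u)"
  show "upper_semicontinuous (grade u)"
    unfolding upper_semicontinuous_def
  proof (intro allI impI)
    fix x c assume c: "grade u x < c"
    show "\<forall>\<^sub>F y in at x. grade u y < c"
    proof (cases "c \<le> 1")
      case True
      have lim: "((\<lambda>y. (y, c)) \<longlongrightarrow> (x, c)) (at x)"
        by (intro tendsto_intros)
      have "open (- endograph u)" "(x, c) \<in> - endograph u"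
        using c cl by (auto simp: mem_endograph)
      from topological_tendstoD[OF lim this]
      have "\<forall>\<^sub>F y in at x. (y, c) \<in> - endograph u" .
      moreover have "0 \<le> c"
        using c grade_bounds(1)[of u x] by linarith
      ultimately show ?thesis
        using True by (auto elim!: eventually_mono simp: mem_endograph)
    next
      case False
      then show ?thesis
        by (intro always_eventually allI) (meson grade_bounds(2) le_less_trans not_le)
    qed
  qed
qed

lemma H_end_eq_0_iff:
  fixes u v :: "'a::metric_space fuzzy_set"
  assumes "upper_semicontinuous (grade u)" "upper_semicontinuous (grade v)"
  shows "H_end u v = 0 \<longleftrightarrow> u = v"
proof
  have sub: "endograph a \<subseteq> endograph b"
    if "H_end a b = 0" "upper_semicontinuous (grade b)" for a b :: "'a fuzzy_set"
  proof
    fix p assume "p \<in> endograph a"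
    from infdist_le_H_end[OF this, of b] that(1) have "infdist p (endograph b) = 0"
      using infdist_nonneg[of p "endograph b"] by linarith
    with that(2) show "p \<in> endograph b"
      by (simp add: in_closed_iff_infdist_zero upper_semicontinuous_iff_closed_endograph)
  qed
  assume "H_end u v = 0"
  then show "u = v"
    using sub[of u v] sub[of v u] assms endograph_inject by (auto simp: H_end_commute)
next
  assume "u = v"
  then have "H_end u v \<le> 0"
    by (simp add: H_end_le_iff)
  then show "H_end u v = 0"
    using H_end_nonneg[of u v] by linarith
qed

text \<open>
  The fuzzy set is the upper boundary \<open>x \<mapsto> Sup {t. (x, t) \<in> E}\<close>; closedness makes these suprema
  attained, so that with downward closure the whole region below the boundary belongs to \<open>E\<close>.
\<close>
lemma closed_subgraph_is_endograph:
  fixes E :: "('a::metric_space \<times> real) set"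
  assumes closed: "closed E"
    and range: "\<And>x t. (x, t) \<in> E \<Longrightarrow> 0 \<le> t \<and> t \<le> 1"
    and base: "\<And>x. (x, 0) \<in> E"
    and down: "\<And>x s t. (x, t) \<in> E \<Longrightarrow> 0 \<le> s \<Longrightarrow> s \<le> t \<Longrightarrow> (x, s) \<in> E"
  shows "\<exists>u. endograph u = E"
proof -
  define S where "S x = {t. (x, t) \<in> E}" for x
  have S: "0 \<in> S x" "bdd_above (S x)" "closed (S x)" for x
  proof -
    have "S x = Pair x -` E" by (auto simp: S_def)
    then show "closed (S x)"
      by (auto intro!: closed_vimage closed continuous_intros)
    show "bdd_above (S x)"
      unfolding bdd_above_def using range by (auto simp: S_def)
  qed (use base in \<open>auto simp: S_def\<close>)
  have mem: "Sup (S x) \<in> S x" for x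
    using S by (intro closed_contains_Sup) auto
  have Sup: "0 \<le> Sup (S x) \<and> Sup (S x) \<le> 1" for x
    using mem[of x] range by (simp add: S_def)
  define u where "u = Fuzzy_set (\<lambda>x. Sup (S x))"
  have u: "grade u x = Sup (S x)" for x
    unfolding u_def using Sup by (subst Fuzzy_set_inverse) auto
  have "(x, t) \<in> endograph u \<longleftrightarrow> (x, t) \<in> E" for x t
  proof
    assume "(x, t) \<in> endograph u"
    then show "(x, t) \<in> E"
      using mem[of x] down[of x "Sup (S x)" t] by (simp add: mem_endograph u S_def)
  next
    assume "(x, t) \<in> E"
    moreover from this have "t \<le> Sup (S x)"
      using S(2) by (intro cSup_upper) (auto simp: S_def)
    ultimately show "(x, t) \<in> endograph u"
      using range[of x t] by (simp add: mem_endograph u)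
  qed
  then show ?thesis by (intro exI[of _ u]) auto
qed

section \<open>Limits of sequences of closed sets\<close>

lemma infdist_attained:
  fixes A :: "'a::heine_borel set"
  assumes "closed A" "A \<noteq> {}"
  obtains a where "a \<in> A" "infdist p A = dist p a"
proof -
  obtain a where a: "a \<in> A" "\<And>b. b \<in> A \<Longrightarrow> dist p a \<le> dist p b"
    using distance_attains_inf[OF assms] by blast
  then have "dist p a \<le> infdist p A"
    using assms(2) by (simp add: infdist_notempty cINF_greatest)
  with a(1) infdist_le[OF a(1), of p] show ?thesis
    by (intro that[of a]) auto
qed

text \<open>
  This is the completeness of the hyperspace of closed sets. The distance functions converge
  uniformly to some \<open>f\<close>, and the limit set is the zero set of \<open>f\<close>. What has to be seen is that \<open>f\<close>
  is again a distance function. It is \<open>1\<close>-Lipschitz, hence at most the distance to its zero set;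
  for the converse, points of the sets closest to \<open>p\<close> accumulate at a zero of \<open>f\<close> at distance
  \<open>f p\<close> from \<open>p\<close>, because bounded sequences have convergent subsequences.
\<close>
lemma uniform_limit_infdist:
  fixes A :: "nat \<Rightarrow> 'a::heine_borel set"
  assumes cl: "\<And>n. closed (A n)" and ne: "\<And>n. A n \<noteq> {}"
    and Cauchy: "uniformly_Cauchy_on UNIV (\<lambda>n p. infdist p (A n))"
  defines "L \<equiv> {p. (\<lambda>n. infdist p (A n)) \<longlonglongrightarrow> 0}"
  shows "closed L"
    and "uniform_limit UNIV (\<lambda>n p. infdist p (A n)) (\<lambda>p. infdist p L) sequentially"
proof -
  obtain f where f: "uniform_limit UNIV (\<lambda>n p. infdist p (A n)) f sequentially"
    using Cauchy uniformly_convergent_eq_Cauchy uniformly_convergent_on_def by metis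
  have lim: "(\<lambda>n. infdist p (A n)) \<longlonglongrightarrow> f p" for p
    using f by (rule tendsto_uniform_limitI) simp
  have L: "p \<in> L \<longleftrightarrow> f p = 0" for p
    using lim[of p] LIMSEQ_unique[OF lim[of p], of 0] by (auto simp: L_def)
  have f_nonneg: "0 \<le> f p" for p
    using lim[of p] by (rule LIMSEQ_le_const) (simp add: infdist_nonneg)
  have lip: "f p \<le> f q + dist p q" for p q
    by (rule LIMSEQ_le[OF lim tendsto_add[OF lim tendsto_const]])
      (auto intro: infdist_triangle)
  have witness: "\<exists>l\<in>L. dist p l = f p" for p
  proof -
    have "\<exists>a. a \<in> A n \<and> infdist p (A n) = dist p a" for n
      using infdist_attained[OF cl ne] by metis
    then obtain a where a: "\<And>n. a n \<in> A n" "\<And>n. infdist p (A n) = dist p (a n)"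
      by metis
    have conv: "(\<lambda>n. dist p (a n)) \<longlonglongrightarrow> f p"
      using lim[of p] by (simp add: a(2))
    then have "Bseq (\<lambda>n. dist p (a n))"
      by (simp add: convergentI convergent_imp_Bseq)
    then have "bounded (range a)"
      by (auto simp: Bseq_def bounded_any_center[of "range a" p] image_iff)
    then obtain l r where r: "strict_mono r" and l: "(a \<circ> r) \<longlonglongrightarrow> l"
      using bounded_imp_convergent_subsequence by blast
    have "(\<lambda>n. dist p ((a \<circ> r) n)) \<longlonglongrightarrow> dist p l"
      by (intro tendsto_intros l)
    moreover have "(\<lambda>n. dist p ((a \<circ> r) n)) \<longlonglongrightarrow> f p"
      using LIMSEQ_subseq_LIMSEQ[OF conv r] by (simp add: o_def)
    ultimately have "dist p l = f p"
      by (rule LIMSEQ_unique)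
    moreover have "f l \<le> 0"
    proof (rule LIMSEQ_le)
      show "(\<lambda>n. infdist l (A (r n))) \<longlonglongrightarrow> f l"
        using LIMSEQ_subseq_LIMSEQ[OF lim r] by (simp add: o_def)
      show "(\<lambda>n. dist l ((a \<circ> r) n)) \<longlonglongrightarrow> 0"
        using tendsto_dist[OF tendsto_const[of l] l] by simp
      show "\<exists>N. \<forall>n\<ge>N. infdist l (A (r n)) \<le> dist l ((a \<circ> r) n)"
        using a(1) by (auto intro: infdist_le)
    qed
    ultimately show ?thesis
      using f_nonneg[of l] L by force
  qed
  then have L_ne: "L \<noteq> {}"
    by blast
  have inf: "infdist p L = f p" for p
  proof (rule antisym)
    show "infdist p L \<le> f p"
      using witness[of p] infdist_le by metis
    have "f p \<le> dist p l" if "l \<in> L" for l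
      using lip[of p l] L that by simp
    then show "f p \<le> infdist p L"
      unfolding infdist_notempty[OF L_ne] by (intro cINF_greatest L_ne)
  qed
  then show "uniform_limit UNIV (\<lambda>n p. infdist p (A n)) (\<lambda>p. infdist p L) sequentially"
    using f by simp
  have "closure L = L"
    using L inf in_closure_iff_infdist_zero[OF L_ne] by auto
  then show "closed L"
    by (simp add: closure_eq)
qed

text \<open>
  The limit set of the endographs is an endograph because the properties of subgraphs pass to
  limits of points: if \<open>(x\<^sub>n, t\<^sub>n)\<close> converges to \<open>(x, t)\<close> and \<open>s \<le> t\<close>, then the lowered points
  \<open>(x\<^sub>n, min t\<^sub>n s)\<close> converge to \<open>(x, s)\<close>.
\<close>
lemma H_end_Cauchy_converges:
  fixes u :: "nat \<Rightarrow> 'a::heine_borel fuzzy_set"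
  assumes usc: "\<And>n. upper_semicontinuous (grade (u n))"
    and Cauchy: "\<And>e. e > 0 \<Longrightarrow> \<exists>N. \<forall>m\<ge>N. \<forall>n\<ge>N. H_end (u m) (u n) < e"
  obtains v where "upper_semicontinuous (grade v)" "(\<lambda>n. H_end (u n) v) \<longlonglongrightarrow> 0"
proof -
  define A where "A n = endograph (u n)" for n
  define E where "E = {p. (\<lambda>n. infdist p (A n)) \<longlonglongrightarrow> 0}"
  have cl: "closed (A n)" and ne: "A n \<noteq> {}" for n
    using usc by (auto simp: A_def upper_semicontinuous_iff_closed_endograph)
  have uC: "uniformly_Cauchy_on UNIV (\<lambda>n p. infdist p (A n))"
    unfolding uniformly_Cauchy_on_def A_def dist_real_def
    by (meson Cauchy infdist_endograph_diff_le le_less_trans)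
  have E: "closed E"
      "uniform_limit UNIV (\<lambda>n p. infdist p (A n)) (\<lambda>p. infdist p E) sequentially"
    using uniform_limit_infdist[OF cl ne uC] unfolding E_def by auto
  have memE: "p \<in> E \<longleftrightarrow> (\<exists>q. (\<forall>n. q n \<in> A n) \<and> q \<longlonglongrightarrow> p)" for p
  proof
    assume p: "p \<in> E"
    have "\<exists>q. q \<in> A n \<and> infdist p (A n) = dist p q" for n
      using infdist_attained[OF cl ne] by metis
    then obtain q where q: "\<And>n. q n \<in> A n" "\<And>n. infdist p (A n) = dist p (q n)"
      by metis
    then have "(\<lambda>n. dist (q n) p) \<longlonglongrightarrow> 0"
      using p by (simp add: E_def dist_commute)
    with q(1) show "\<exists>q. (\<forall>n. q n \<in> A n) \<and> q \<longlonglongrightarrow> p"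
      using tendsto_dist_iff by blast
  next
    assume "\<exists>q. (\<forall>n. q n \<in> A n) \<and> q \<longlonglongrightarrow> p"
    then obtain q where q: "\<And>n. q n \<in> A n" "q \<longlonglongrightarrow> p" by blast
    have "(\<lambda>n. dist p (q n)) \<longlonglongrightarrow> 0"
      using tendsto_dist[OF tendsto_const[of p] q(2)] by simp
    then have "(\<lambda>n. infdist p (A n)) \<longlonglongrightarrow> 0"
      by (rule tendsto_0_le[where K = 1])
        (use q(1) in \<open>auto simp: infdist_le infdist_nonneg\<close>)
    then show "p \<in> E" by (simp add: E_def)
  qed
  have "\<exists>v. endograph v = E"
  proof (rule closed_subgraph_is_endograph[OF E(1)])
    fix x t assume "(x, t) \<in> E"
    then obtain q where q: "\<And>n. q n \<in> A n" "q \<longlonglongrightarrow> (x, t)" by (auto simp: memE)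
    have lim: "(\<lambda>n. fst (q n)) \<longlonglongrightarrow> x" "(\<lambda>n. snd (q n)) \<longlonglongrightarrow> t"
      using tendsto_fst[OF q(2)] tendsto_snd[OF q(2)] by auto
    have bounds: "0 \<le> snd (q n)" "snd (q n) \<le> 1" "snd (q n) \<le> grade (u n) (fst (q n))" for n
      using q(1)[of n] by (auto simp: A_def endograph_def)
    show "0 \<le> t \<and> t \<le> 1"
      using bounds by (auto intro: tendsto_lowerbound[OF lim(2)] tendsto_upperbound[OF lim(2)])
    fix s assume s: "0 \<le> s" "s \<le> t"
    have "(\<lambda>n. (fst (q n), min (snd (q n)) s)) \<longlonglongrightarrow> (x, min t s)"
      by (intro tendsto_intros lim)
    then have "(\<lambda>n. (fst (q n), min (snd (q n)) s)) \<longlonglongrightarrow> (x, s)"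
      using s by (simp add: min_absorb2)
    moreover have "(fst (q n), min (snd (q n)) s) \<in> A n" for n
      using bounds[of n] s by (auto simp: A_def mem_endograph)
    ultimately show "(x, s) \<in> E"
      unfolding memE by (intro exI[of _ "\<lambda>n. (fst (q n), min (snd (q n)) s)"]) simp
  next
    fix x show "(x, 0) \<in> E"
      unfolding memE by (intro exI[of _ "\<lambda>_. (x, 0)"]) (simp add: A_def mem_endograph)
  qed
  then obtain v where v: "endograph v = E" ..
  show thesis
  proof
    show "upper_semicontinuous (grade v)"
      by (simp add: upper_semicontinuous_iff_closed_endograph v E(1))
    show "(\<lambda>n. H_end (u n) v) \<longlonglongrightarrow> 0"
    proof (rule LIMSEQ_I)
      fix e :: real assume e: "e > 0"
      have "\<forall>\<^sub>F n in sequentially. \<forall>p\<in>UNIV. dist (infdist p (A n)) (infdist p E) < e / 2"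
        using E(2) e by (intro uniform_limitD) auto
      then obtain N where N: "\<And>n p. n \<ge> N \<Longrightarrow> \<bar>infdist p (A n) - infdist p E\<bar> < e / 2"
        by (auto simp: eventually_sequentially dist_real_def)
      have "H_end (u n) v \<le> e / 2" if "n \<ge> N" for n
        unfolding H_end_le_iff
      proof (intro conjI ballI)
        fix p assume "p \<in> endograph (u n)"
        then show "infdist p (endograph v) \<le> e / 2"
          using N[OF that, of p] by (simp add: A_def v)
      next
        fix p assume "p \<in> endograph v"
        then show "infdist p (endograph (u n)) \<le> e / 2"
          using N[OF that, of p] by (simp add: A_def v)
      qed
      then have "norm (H_end (u n) v - 0) < e" if "n \<ge> N" for n
        using that e H_end_nonneg[of "u n" v] by (fastforce simp: abs_of_nonneg)
      then show "\<exists>N. \<forall>n\<ge>N. norm (H_end (u n) v - 0) < e"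
        by blast
    qed
  qed
qed

section \<open>Star-shaped numbers are closed under limits\<close>

text \<open>
  The Euclidean distance on the product dominates the distances of both coordinates, so a nearby
  endograph has a point that is close in space and whose level is hardly lower.
\<close>
lemma near_point_of_lower_cut:
  fixes u v :: "'a::metric_space fuzzy_set"
  assumes "H_end u v < e" "t \<le> grade u x" "0 \<le> t" "t \<le> 1"
  obtains y where "dist x y < e" "t - e \<le> grade v y"
proof -
  have "(x, t) \<in> endograph u"
    using assms by (simp add: mem_endograph)
  then have "infdist (x, t) (endograph v) < e"
    using infdist_le_H_end assms(1) le_less_trans by blast
  then obtain p where p: "p \<in> endograph v" "dist (x, t) p < e"
    unfolding infdist_notempty[OF endograph_nonempty]
    using cInf_lessD[of "dist (x, t) ` endograph v" e] by auto
  obtain y s where ys: "p = (y, s)" by force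
  have "dist x y < e" "dist t s < e"
    using p(2) dist_fst_le[of "(x, t)" p] dist_snd_le[of "(x, t)" p] by (auto simp: ys)
  moreover have "s \<le> grade v y"
    using p(1) by (simp add: ys mem_endograph)
  ultimately show thesis
    by (intro that[of y]) (auto simp: dist_real_def)
qed

lemma grade_limit_ge:
  fixes u :: "nat \<Rightarrow> 'a::metric_space fuzzy_set"
  assumes usc: "upper_semicontinuous (grade v)"
    and H: "(\<lambda>n. H_end (u n) v) \<longlonglongrightarrow> 0"
    and ge: "\<forall>\<^sub>F n in sequentially. 0 \<le> t n \<and> t n \<le> 1 \<and> t n \<le> grade (u n) (x n)"
    and lim: "x \<longlonglongrightarrow> x0" "t \<longlonglongrightarrow> t0"
  shows "t0 \<le> grade v x0"
proof -
  have "(\<lambda>n. infdist (x n, t n) (endograph v)) \<longlonglongrightarrow> infdist (x0, t0) (endograph v)"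
    by (intro tendsto_intros lim)
  moreover have "(\<lambda>n. infdist (x n, t n) (endograph v)) \<longlonglongrightarrow> 0"
    using H
  proof (rule tendsto_0_le[where K = 1])
    show "\<forall>\<^sub>F n in sequentially. norm (infdist (x n, t n) (endograph v)) \<le> norm (H_end (u n) v) * 1"
      using ge by eventually_elim
        (auto simp: infdist_nonneg H_end_nonneg mem_endograph intro!: infdist_le_H_end)
  qed
  ultimately have "infdist (x0, t0) (endograph v) = 0"
    by (rule LIMSEQ_unique)
  then have "(x0, t0) \<in> endograph v"
    using usc by (simp add: in_closed_iff_infdist_zero upper_semicontinuous_iff_closed_endograph)
  then show ?thesis by (simp add: mem_endograph)
qed

lemma bounded_cut_of_near:
  fixes u v :: "'a::metric_space fuzzy_set"
  assumes H: "H_end v u < \<alpha> / 2" and \<alpha>: "0 < \<alpha>" "\<alpha> \<le> 1" and bd: "bounded (cut u (\<alpha> / 2))"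
  shows "bounded (cut v \<alpha>)"
proof -
  obtain a B where B: "\<And>y. y \<in> cut u (\<alpha> / 2) \<Longrightarrow> dist a y \<le> B"
    using bd by (auto simp: bounded_def)
  have "dist a x \<le> B + \<alpha> / 2" if "x \<in> cut v \<alpha>" for x
  proof -
    have "\<alpha> \<le> grade v x"
      using that \<alpha> by (simp add: mem_cut)
    then obtain y where "dist x y < \<alpha> / 2" "\<alpha> - \<alpha> / 2 \<le> grade u y"
      using near_point_of_lower_cut[OF H _ less_imp_le] \<alpha> by blast
    then show ?thesis
      using B[of y] dist_triangle2[of a x y] \<alpha> by (simp add: mem_cut)
  qed
  then show ?thesis
    unfolding bounded_def by blast
qed

text \<open>
  Points at levels bounded away from \<open>0\<close> stay near one bounded cut of the limit, although the cuts
  of the members of the sequence need not be uniformly bounded.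
\<close>
lemma convergent_subsequence_of_cut_points:
  fixes u :: "nat \<Rightarrow> 'a::heine_borel fuzzy_set"
  assumes H: "(\<lambda>n. H_end (u n) v) \<longlonglongrightarrow> 0"
    and bd: "\<And>\<alpha>. 0 < \<alpha> \<Longrightarrow> \<alpha> \<le> 1 \<Longrightarrow> bounded (cut v \<alpha>)"
    and s: "0 < s" "s \<le> 1"
    and x: "\<And>n. s \<le> grade (u n) (x n)"
  obtains r x0 where "strict_mono r" "(x \<circ> r) \<longlonglongrightarrow> x0"
proof -
  have "\<forall>\<^sub>F n in sequentially. H_end (u n) v < s / 2"
    using H s by (intro order_tendstoD) auto
  then obtain N where N: "\<And>n. n \<ge> N \<Longrightarrow> H_end (u n) v < s / 2"
    by (auto simp: eventually_sequentially)
  obtain a B where B: "\<And>y. y \<in> cut v (s / 2) \<Longrightarrow> dist a y \<le> B"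
    using bd[of "s / 2"] s by (auto simp: bounded_def)
  have "dist a (x (n + N)) \<le> B + s / 2" for n
  proof -
    obtain y where "dist (x (n + N)) y < s / 2" "s - s / 2 \<le> grade v y"
      using near_point_of_lower_cut[OF N x, of "n + N"] s by auto
    then show ?thesis
      using B[of y] dist_triangle2[of a "x (n + N)" y] s by (simp add: mem_cut)
  qed
  then have "bounded (range (\<lambda>n. x (n + N)))"
    unfolding bounded_def by blast
  then obtain x0 r where r: "strict_mono r" "((\<lambda>n. x (n + N)) \<circ> r) \<longlonglongrightarrow> x0"
    using bounded_imp_convergent_subsequence by blast
  show thesis
    by (rule that[of "\<lambda>n. r n + N" x0]) (use r in \<open>auto simp: strict_mono_def o_def\<close>)
qed

text \<open>
  The cuts \<open>[u\<^sub>n]\<^sub>\<alpha>\<close> need not converge to \<open>[v]\<^sub>\<alpha>\<close>, so centres of \<open>[u\<^sub>n]\<^sub>\<alpha>\<close> are of no use. But every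
  point of \<open>[v]\<^sub>\<alpha>\<close> is a limit of points of the cuts of \<open>u\<^sub>n\<close> at the levels \<open>\<alpha> - \<epsilon>\<^sub>n\<close>, where \<open>\<epsilon>\<^sub>n\<close>
  exceeds the distance and tends to \<open>0\<close>. Any accumulation point of centres of these lower cuts
  is a centre of \<open>[v]\<^sub>\<alpha>\<close>.
\<close>
lemma starlike_cut_of_limit:
  fixes u :: "nat \<Rightarrow> (real ^ 'n) fuzzy_set"
  assumes usc: "upper_semicontinuous (grade v)"
    and H: "(\<lambda>n. H_end (u n) v) \<longlonglongrightarrow> 0"
    and bd: "\<And>\<alpha>. 0 < \<alpha> \<Longrightarrow> \<alpha> \<le> 1 \<Longrightarrow> bounded (cut v \<alpha>)"
    and star: "\<And>n \<alpha>. 0 < \<alpha> \<Longrightarrow> \<alpha> \<le> 1 \<Longrightarrow> starlike (cut (u n) \<alpha>)"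
    and \<alpha>: "0 < \<alpha>" "\<alpha> \<le> 1"
  shows "starlike (cut v \<alpha>)"
proof -
  define \<epsilon> where "\<epsilon> n = H_end (u n) v + inverse (real (Suc n))" for n
  have \<epsilon>: "\<epsilon> \<longlonglongrightarrow> 0"
    unfolding \<epsilon>_def using tendsto_add[OF H LIMSEQ_inverse_real_of_nat] by simp
  have \<epsilon>_pos: "0 < \<epsilon> n" "H_end (u n) v < \<epsilon> n" for n
    using H_end_nonneg[of "u n" v] by (auto simp: \<epsilon>_def intro: add_nonneg_pos)
  \<comment> \<open>The maximum keeps the first few levels positive; it does not affect the limit.\<close>
  define \<beta> where "\<beta> n = max (\<alpha> / 2) (\<alpha> - \<epsilon> n)" for n
  have "\<beta> \<longlonglongrightarrow> max (\<alpha> / 2) (\<alpha> - 0)"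
    unfolding \<beta>_def by (intro tendsto_intros \<epsilon>)
  then have \<beta>: "\<beta> \<longlonglongrightarrow> \<alpha>"
    using \<alpha> by simp
  have \<beta>_bounds: "\<alpha> / 2 \<le> \<beta> n" "0 < \<beta> n" "\<beta> n \<le> 1" for n
    using \<alpha> \<epsilon>_pos(1)[of n] by (auto simp: \<beta>_def)
  have ev: "\<forall>\<^sub>F n in sequentially. \<beta> n = \<alpha> - \<epsilon> n"
    using order_tendstoD(2)[OF \<epsilon>, of "\<alpha> / 2"] \<alpha>
    by (auto elim!: eventually_mono simp: \<beta>_def)
  have "\<exists>c. c \<in> cut (u n) (\<beta> n) \<and> (\<forall>y\<in>cut (u n) (\<beta> n). closed_segment c y \<subseteq> cut (u n) (\<beta> n))"
    for n
    using star[OF \<beta>_bounds(2,3), of n] by (auto simp: starlike_def)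
  then obtain c where c: "\<And>n. c n \<in> cut (u n) (\<beta> n)"
    and seg: "\<And>n y. y \<in> cut (u n) (\<beta> n) \<Longrightarrow> closed_segment (c n) y \<subseteq> cut (u n) (\<beta> n)"
    by metis
  have "\<alpha> / 2 \<le> grade (u n) (c n)" for n
    using c[of n] \<beta>_bounds[of n] by (simp add: mem_cut)
  then obtain r c0 where r: "strict_mono r" and c0: "(c \<circ> r) \<longlonglongrightarrow> c0"
    using convergent_subsequence_of_cut_points[OF H bd, of "\<alpha> / 2" c] \<alpha> by auto
  have Hr: "(\<lambda>n. H_end (u (r n)) v) \<longlonglongrightarrow> 0" and \<beta>r: "(\<lambda>n. \<beta> (r n)) \<longlonglongrightarrow> \<alpha>"
    using LIMSEQ_subseq_LIMSEQ[OF H r] LIMSEQ_subseq_LIMSEQ[OF \<beta> r] by (auto simp: o_def)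
  have limit_mem: "z0 \<in> cut v \<alpha>"
    if "\<forall>\<^sub>F n in sequentially. z n \<in> cut (u (r n)) (\<beta> (r n))" "z \<longlonglongrightarrow> z0" for z z0
  proof -
    have "\<forall>\<^sub>F n in sequentially.
        0 \<le> \<beta> (r n) \<and> \<beta> (r n) \<le> 1 \<and> \<beta> (r n) \<le> grade (u (r n)) (z n)"
      using that(1) by eventually_elim (use \<beta>_bounds in \<open>auto simp: mem_cut less_imp_le\<close>)
    from grade_limit_ge[OF usc Hr this that(2) \<beta>r] show ?thesis
      using \<alpha> by (simp add: mem_cut)
  qed
  have "c0 \<in> cut v \<alpha>"
    using limit_mem[of "c \<circ> r" c0] c c0 by simp
  moreover have "closed_segment c0 y \<subseteq> cut v \<alpha>" if y: "y \<in> cut v \<alpha>" for y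
  proof
    fix z assume "z \<in> closed_segment c0 y"
    then obtain k where k: "0 \<le> k" "k \<le> 1" and z: "z = (1 - k) *\<^sub>R c0 + k *\<^sub>R y"
      by (auto simp: closed_segment_def)
    have "\<exists>w. dist y w < \<epsilon> n \<and> \<alpha> - \<epsilon> n \<le> grade (u n) w" for n
      using near_point_of_lower_cut[of v "u n" "\<epsilon> n" \<alpha> y] \<epsilon>_pos(2)[of n] y \<alpha>
      by (metis H_end_commute less_imp_le mem_cut)
    then obtain w where w: "\<And>n. dist y (w n) < \<epsilon> n" "\<And>n. \<alpha> - \<epsilon> n \<le> grade (u n) (w n)"
      by metis
    have "w \<longlonglongrightarrow> y"
      unfolding tendsto_dist_iff[of w]
      by (rule tendsto_0_le[OF \<epsilon>, where K = 1])
        (use w(1) \<epsilon>_pos(1) in \<open>auto simp: dist_commute less_imp_le\<close>)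
    then have wr: "(\<lambda>n. w (r n)) \<longlonglongrightarrow> y"
      using LIMSEQ_subseq_LIMSEQ[OF _ r] by (auto simp: o_def)
    have "\<forall>\<^sub>F n in sequentially. w n \<in> cut (u n) (\<beta> n)"
      using ev by eventually_elim (use w(2) \<beta>_bounds(2) in \<open>metis mem_cut\<close>)
    then have "\<forall>\<^sub>F n in sequentially. w (r n) \<in> cut (u (r n)) (\<beta> (r n))"
      using eventually_subseq[OF r] by blast
    then have "\<forall>\<^sub>F n in sequentially.
        (1 - k) *\<^sub>R c (r n) + k *\<^sub>R w (r n) \<in> cut (u (r n)) (\<beta> (r n))"
      by eventually_elim (use seg k in \<open>force simp: closed_segment_def\<close>)
    moreover have "(\<lambda>n. (1 - k) *\<^sub>R c (r n) + k *\<^sub>R w (r n)) \<longlonglongrightarrow> z"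
      unfolding z using c0 by (intro tendsto_intros wr) (simp add: o_def)
    ultimately show "z \<in> cut v \<alpha>"
      by (rule limit_mem)
  qed
  ultimately show ?thesis
    unfolding starlike_def by blast
qed

lemma star_numbers_nc_limit:
  fixes u :: "nat \<Rightarrow> (real ^ 'n) fuzzy_set"
  assumes u: "\<And>n. u n \<in> star_numbers_nc"
    and usc: "upper_semicontinuous (grade v)"
    and H: "(\<lambda>n. H_end (u n) v) \<longlonglongrightarrow> 0"
  shows "v \<in> star_numbers_nc"
proof -
  have bd: "bounded (cut v \<alpha>)" if \<alpha>: "0 < \<alpha>" "\<alpha> \<le> 1" for \<alpha>
  proof -
    have "\<forall>\<^sub>F n in sequentially. H_end (u n) v < \<alpha> / 2"
      using H \<alpha> by (intro order_tendstoD) auto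
    then obtain n where "H_end (u n) v < \<alpha> / 2"
      by (auto simp: eventually_sequentially)
    moreover have "bounded (cut (u n) (\<alpha> / 2))"
      using u[of n] \<alpha> by (auto simp: star_numbers_nc_def)
    ultimately show ?thesis
      using \<alpha> by (intro bounded_cut_of_near[of v "u n"]) (auto simp: H_end_commute)
  qed
  have "\<exists>x. grade (u n) x = 1" for n
    using u[of n] by (auto simp: star_numbers_nc_def star_shaped_fuzzy_def)
  then obtain x where x: "\<And>n. grade (u n) (x n) = 1" by metis
  then obtain r x0 where r: "strict_mono r" and x0: "(x \<circ> r) \<longlonglongrightarrow> x0"
    using convergent_subsequence_of_cut_points[OF H bd, of 1 x] by auto
  have "(\<lambda>n. H_end (u (r n)) v) \<longlonglongrightarrow> 0"
    using LIMSEQ_subseq_LIMSEQ[OF H r] by (simp add: o_def)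
  then have "1 \<le> grade v x0"
    by (rule grade_limit_ge[OF usc _ _ x0, where t = "\<lambda>_. 1"]) (auto simp: x)
  then have "grade v x0 = 1"
    by (intro antisym) auto
  moreover have "starlike (cut v \<alpha>)" if "0 < \<alpha>" "\<alpha> \<le> 1" for \<alpha>
    using starlike_cut_of_limit[OF usc H bd _ that] u
    by (auto simp: star_numbers_nc_def star_shaped_fuzzy_def)
  ultimately show ?thesis
    using usc bd by (auto simp: star_numbers_nc_def star_shaped_fuzzy_def)
qed

section \<open>Density of the numbers with bounded support\<close>

lemma star_numbers_subset_nc: "star_numbers \<subseteq> star_numbers_nc"
proof
  fix u :: "(real ^ 'n) fuzzy_set" assume u: "u \<in> star_numbers"
  have "cut u \<alpha> \<subseteq> cut u 0" if "0 < \<alpha>" for \<alpha>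
    using that closure_subset by (fastforce simp: cut_def)
  with u show "u \<in> star_numbers_nc"
    unfolding star_numbers_def star_numbers_nc_def
    by (simp add: bounded_subset[of "cut u 0"])
qed

text \<open>
  Setting all grades below \<open>e\<close> to \<open>0\<close> cuts the tail off: the support becomes the bounded cut at
  level \<open>e\<close>, every cut of the result at a positive level is one of the cuts of \<open>u\<close>, and
  no point of the endograph drops by \<open>e\<close> or more.
\<close>
lemma star_numbers_dense:
  fixes u :: "(real ^ 'n) fuzzy_set"
  assumes u: "u \<in> star_numbers_nc" and e: "0 < e" "e \<le> 1"
  obtains v where "v \<in> star_numbers" "H_end u v \<le> e"
proof -
  define v where "v = Fuzzy_set (\<lambda>x. if e \<le> grade u x then grade u x else 0)"
  have v: "grade v x = (if e \<le> grade u x then grade u x else 0)" for x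
    unfolding v_def by (subst Fuzzy_set_inverse) auto
  have cut: "cut v \<alpha> = cut u (max \<alpha> e)" if "0 < \<alpha>" for \<alpha>
    using that e by (auto simp: mem_cut v split: if_splits)
  have usc: "upper_semicontinuous (grade u)"
    using u by (simp add: star_numbers_nc_def star_shaped_fuzzy_def)
  have "upper_semicontinuous (grade v)"
    unfolding upper_semicontinuous_def
  proof (intro allI impI)
    fix x c assume c: "grade v x < c"
    show "\<forall>\<^sub>F y in at x. grade v y < c"
    proof (cases "e \<le> grade u x")
      case True
      then have "\<forall>\<^sub>F y in at x. grade u y < c"
        using usc c by (simp add: upper_semicontinuous_def v)
      moreover have "0 < c"
        using c True e by (simp add: v)
      ultimately show ?thesis
        by (auto elim!: eventually_mono simp: v)
    next
      case False
      then have "\<forall>\<^sub>F y in at x. grade u y < e"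
        using usc by (simp add: upper_semicontinuous_def)
      then show ?thesis
        using c False by (auto elim!: eventually_mono simp: v)
    qed
  qed
  moreover obtain x0 where "grade u x0 = 1"
    using u by (auto simp: star_numbers_nc_def star_shaped_fuzzy_def)
  then have "grade v x0 = 1"
    using e by (simp add: v)
  moreover have "starlike (cut v \<alpha>)" if "0 < \<alpha>" "\<alpha> \<le> 1" for \<alpha>
    using u e that by (simp add: cut star_numbers_nc_def star_shaped_fuzzy_def)
  moreover have "bounded (cut v 0)"
  proof -
    have "{x. grade v x > 0} = cut u e"
      using e by (auto simp: mem_cut v)
    then show ?thesis
      using u e by (auto simp: cut_def[of v] star_numbers_nc_def)
  qed
  ultimately have "v \<in> star_numbers"
    by (auto simp: star_numbers_def star_shaped_fuzzy_def)
  moreover have "H_end u v \<le> e"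
    unfolding H_end_le_iff
  proof (intro conjI ballI)
    fix p assume p: "p \<in> endograph u"
    obtain x t where xt: "p = (x, t)" by force
    show "infdist p (endograph v) \<le> e"
    proof (cases "e \<le> grade u x")
      case True
      then have "p \<in> endograph v"
        using p by (simp add: xt mem_endograph v)
      then show ?thesis using e by simp
    next
      case False
      then have "dist p (x, 0) \<le> e"
        using p by (simp add: xt mem_endograph dist_Pair_Pair)
      then show ?thesis
        by (rule infdist_le2[rotated]) (simp add: mem_endograph)
    qed
  next
    fix p assume "p \<in> endograph v"
    then have "p \<in> endograph u"
      by (cases p) (auto simp: mem_endograph v split: if_splits)
    then show "infdist p (endograph u) \<le> e"
      using e by simp
  qed
  ultimately show thesis ..
qed

section \<open>The completion\<close>

lemma Metric_space_star_numbers_nc: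
  "Metric_space (star_numbers_nc :: (real ^ 'n) fuzzy_set set) H_end"
proof
  fix u v :: "(real ^ 'n) fuzzy_set"
  assume "u \<in> star_numbers_nc" "v \<in> star_numbers_nc"
  then show "H_end u v = 0 \<longleftrightarrow> u = v"
    by (intro H_end_eq_0_iff) (auto simp: star_numbers_nc_def star_shaped_fuzzy_def)
qed (rule H_end_nonneg H_end_commute H_end_triangle)+

theorem theorem9p7:
  shows "Metric_space (star_numbers_nc :: (real ^ 'n) fuzzy_set set) H_end
    \<and> Metric_space.mcomplete (star_numbers_nc :: (real ^ 'n) fuzzy_set set) H_end
    \<and> (star_numbers :: (real ^ 'n) fuzzy_set set) \<subseteq> star_numbers_nc
    \<and> Metric_space.mtopology (star_numbers_nc :: (real ^ 'n) fuzzy_set set) H_end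
         closure_of star_numbers = star_numbers_nc"
proof -
  interpret Metric_space "star_numbers_nc :: (real ^ 'n) fuzzy_set set" H_end
    by (rule Metric_space_star_numbers_nc)
  have "mcomplete"
    unfolding mcomplete_def
  proof (intro allI impI)
    fix u :: "nat \<Rightarrow> (real ^ 'n) fuzzy_set"
    assume "MCauchy u"
    then have u: "\<And>n. u n \<in> star_numbers_nc"
      and Cauchy: "\<And>e. e > 0 \<Longrightarrow> \<exists>N. \<forall>m\<ge>N. \<forall>n\<ge>N. H_end (u m) (u n) < e"
      by (auto simp: MCauchy_def)
    from u have "\<And>n. upper_semicontinuous (grade (u n))"
      by (simp add: star_numbers_nc_def star_shaped_fuzzy_def)
    from H_end_Cauchy_converges[OF this Cauchy] obtain v where
      v: "upper_semicontinuous (grade v)" "(\<lambda>n. H_end (u n) v) \<longlonglongrightarrow> 0"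
      by blast
    have "v \<in> star_numbers_nc"
      by (rule star_numbers_nc_limit[OF u v])
    then have "limitin mtopology u v sequentially"
      unfolding limitin_metric using u order_tendstoD(2)[OF v(2)] by auto
    then show "\<exists>v. limitin mtopology u v sequentially" ..
  qed
  moreover have "mtopology closure_of star_numbers = star_numbers_nc"
  proof -
    have "\<exists>v\<in>star_numbers. v \<in> mball u e" if u: "u \<in> star_numbers_nc" and e: "e > 0" for u e
    proof -
      obtain v where "v \<in> star_numbers" "H_end u v \<le> min (e / 2) 1"
        using star_numbers_dense[OF u, of "min (e / 2) 1"] e by auto
      then show ?thesis
        using u e star_numbers_subset_nc by (intro bexI[of _ v]) auto
    qed
    then show ?thesis
      by (auto simp: metric_closure_of)
  qed
  ultimately show ?thesis
    using Metric_space_star_numbers_nc star_numbers_subset_nc by blast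
qed

end
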